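(* Let $P_A(\lambda;\varphi)$ be the vector partition function associated with a function $\varphi:\mathbb Z^N_\geqslant\to\mathbb C$, let $\Phi(\xi)=\sum_{x\in\mathbb Z^N_\geqslant}\varphi(x)\xi^x$ be the generating series for $\varphi$, and let $c=(c_1,\dots,c_N)\in\mathbb C^N$. Then $$\sum_{J\in V}(-1)^{\#J}\,\pi_J\Big[(1-\langle c,\xi\rangle)\Phi(\xi)\Big]\Big|_{\xi=z^A}=\sum_{\lambda\in K\cap\mathbb Z^n}P_A(\lambda;Q(\delta)\varphi)\,z^{\lambda}.$$
   Context: Let $\Delta=\{\alpha^1,\dots,\alpha^N\}\subset\mathbb Z^n$ be a finite set of column vectors, $A=[\alpha^1,\dots,\alpha^N]$ the $n\times N$ matrix with these columns, and $K=\{x_1\alpha^1+\cdots+x_N\alpha^N: x\in\mathbb R^N,\ x_j\ge 0\}$ the cone they span. It is assumed that $K$ is pointed, in the sense that $\alpha^1,\dots,\alpha^N$ all lie in an open half-space $\{v\in\mathbb R^n:\ell(v)>0\}$ for some linear functional $\ell$; hence for every $\lambda\in\mathbb Z^n$ there are only finitely many $x\in\mathbb Z^N_\geqslant$ with $Ax=\lambda$. Here $\mathbb Z^N_\geqslant$ is the set of integer vectors with non-negative coordinates. For $\psi:\mathbb Z^N_\geqslant\to\mathbb C$ the vector partition function associated with $\psi$ is $P_A(\lambda;\psi)=\sum_{x\in\mathbb Z^N_\geqslant,\ Ax=\lambda}\psi(x)$, $\lambda\in\mathbb Z^n$. The shift operators are $\delta_j\varphi(x)=\varphi(x_1,\dots,x_{j-1},x_j+1,x_{j+1},\dots,x_N)$,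 $j=1,\dots,N$, and $Q(\delta)=\delta_1\cdots\delta_N-c_1\delta_2\cdots\delta_N-\cdots-c_N\delta_1\cdots\delta_{N-1}$ (the $j$-th subtracted term is $c_j\prod_{i\ne j}\delta_i$). Thus $(Q(\delta)\varphi)(x)=\varphi(x+I)-\sum_{j=1}^N c_j\varphi(x+I-e^j)$ for $x\in\mathbb Z^N_\geqslant$, where $e^1,\dots,e^N$ are the standard basis vectors of $\mathbb Z^N$ and $I=(1,\dots,1)$. $\langle c,\xi\rangle=c_1\xi_1+\cdots+c_N\xi_N$. $V$ is the set of all ordered sets $J=(j_1,\dots,j_k)$ with $1\le j_1<\cdots<j_k\le N$, $k=0,1,\dots,N$ (including the empty one), and $\#J=k$. The operator $\pi_j:\mathbb C[[\xi]]\to\mathbb C[[\xi]]$, $\xi=(\xi_1,\dots,\xi_N)$, sets $\xi_j=0$: $\pi_j\Phi(\xi)=\Phi(\xi_1,\dots,\xi_{j-1},0,\xi_{j+1},\dots,\xi_N)$; $\pi_J=\pi_{j_1}\circ\cdots\circ\pi_{j_k}$ and $\pi_\emptyset$ is the identity operator. The substitution $\xi=z^A=(z^{\alpha^1},\dots,z^{\alpha^N})$, with $z=(z_1,\dots,z_n)$, replaces $\xi^x$ by $z^{Ax}$ and is applied after the operators $\pi_J$.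
   Formalization: The right-hand side is multiplied by z^{AI}, I=(1,…,1) (AI is the sum of the columns of A); without this factor the formula fails, e.g. for N=n=1, A=(1), c=0, φ=1, where the left side is z/(1−z) and the printed right side is 1/(1−z). *)

theory Defs
  imports "HOL-Analysis.Analysis"
begin

section \<open>Formal power series in finitely many variables\<close>

text \<open>
  An exponent vector is an element of \<^typ>\<open>nat ^ 'i\<close>; a series is the family of its coefficients.
\<close>

typedef ('a, 'i) mfps = "UNIV :: (nat ^ 'i::finite \<Rightarrow> 'a) set"
  morphisms mfps_nth Abs_mfps
  by simp

lemma mfps_nth_Abs [simp]: "mfps_nth (Abs_mfps f) = f"
  by (simp add: Abs_mfps_inverse)

lemma mfps_eq_iff: "F = G \<longleftrightarrow> (\<forall>x. mfps_nth F x = mfps_nth G x)"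
  by (metis ext mfps_nth_inject)

lemma finite_nat_vec_le: "finite {u :: nat ^ 'i::finite. \<forall>i. u $ i \<le> b i}"
proof -
  have "finite (PiE (UNIV :: 'i set) (\<lambda>i. {..b i}))"
    by (intro finite_PiE) auto
  then have "finite ((\<lambda>f. \<chi> i. f i) ` PiE (UNIV :: 'i set) (\<lambda>i. {..b i}))"
    by (rule finite_imageI)
  moreover have "{u :: nat ^ 'i. \<forall>i. u $ i \<le> b i}
      \<subseteq> (\<lambda>f. \<chi> i. f i) ` PiE (UNIV :: 'i set) (\<lambda>i. {..b i})"
  proof
    fix u :: "nat ^ 'i" assume "u \<in> {u. \<forall>i. u $ i \<le> b i}"
    then have "u = (\<chi> i. (\<lambda>i. u $ i) i)" "(\<lambda>i. u $ i) \<in> PiE UNIV (\<lambda>i. {..b i})"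
      by (auto simp: vec_eq_iff)
    then show "u \<in> (\<lambda>f. \<chi> i. f i) ` PiE (UNIV :: 'i set) (\<lambda>i. {..b i})"
      by blast
  qed
  ultimately show ?thesis by (rule rev_finite_subset)
qed

lemma finite_nat_vec_decomp: "finite {(u, v). u + v = (x :: nat ^ 'i::finite)}"
proof (rule finite_subset)
  show "{(u, v). u + v = x} \<subseteq> {u. \<forall>i. u $ i \<le> x $ i} \<times> {v. \<forall>i. v $ i \<le> x $ i}"
    by auto
  show "finite ({u :: nat ^ 'i. \<forall>i. u $ i \<le> x $ i} \<times> {v :: nat ^ 'i. \<forall>i. v $ i \<le> x $ i})"
    by (intro finite_cartesian_product finite_nat_vec_le)
qed

instantiation mfps :: (comm_ring_1, finite) comm_ring_1
begin

definition "0 = Abs_mfps (\<lambda>x. 0)"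
definition "1 = Abs_mfps (\<lambda>x. if x = 0 then 1 else 0)"
definition "F + G = Abs_mfps (\<lambda>x. mfps_nth F x + mfps_nth G x)"
definition "- F = Abs_mfps (\<lambda>x. - mfps_nth F x)"
definition "F - G = Abs_mfps (\<lambda>x. mfps_nth F x - mfps_nth G x)"
definition "F * G = Abs_mfps (\<lambda>x. \<Sum>(u, v) | u + v = x. mfps_nth F u * mfps_nth G v)"

instance
proof
  fix F G H :: "('a, 'b) mfps"
  show "F + G + H = F + (G + H)" "F + G = G + F" "0 + F = F" "- F + F = 0" "F - G = F + - G"
    by (simp_all add: mfps_eq_iff plus_mfps_def zero_mfps_def uminus_mfps_def minus_mfps_def
        algebra_simps)
  show "(0 :: ('a, 'b) mfps) \<noteq> 1"
    by (auto simp: mfps_eq_iff zero_mfps_def one_mfps_def)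
  show "(F + G) * H = F * H + G * H"
    by (simp add: mfps_eq_iff times_mfps_def plus_mfps_def case_prod_unfold ring_distribs
        sum.distrib)
  show "F * G = G * F"
    unfolding times_mfps_def
    by (intro arg_cong[where f = Abs_mfps] ext sum.reindex_bij_witness[of _ prod.swap prod.swap])
      (auto simp: add.commute mult.commute)
  show "1 * F = F"
  proof (unfold mfps_eq_iff, intro allI)
    fix x :: "nat ^ 'b"
    have "mfps_nth (1 * F) x
        = (\<Sum>(u, v) | u + v = x. (if u = 0 then 1 else 0) * mfps_nth F v)"
      by (simp add: times_mfps_def one_mfps_def)
    also have "\<dots> = (\<Sum>(u, v) \<in> {(0 :: nat ^ 'b, x)}. (if u = 0 then 1 else 0) * mfps_nth F v)"
      by (intro sum.mono_neutral_right finite_nat_vec_decomp) (auto split: if_splits)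
    finally show "mfps_nth (1 * F) x = mfps_nth F x" by simp
  qed
  show "F * G * H = F * (G * H)"
  proof (unfold mfps_eq_iff, intro allI)
    fix x :: "nat ^ 'b"
    let ?f = "\<lambda>(u, v, w). mfps_nth F u * mfps_nth G v * mfps_nth H w"
    have "mfps_nth (F * G * H) x = (\<Sum>p | fst p + snd p = x. \<Sum>q | fst q + snd q = fst p.
        mfps_nth F (fst q) * mfps_nth G (snd q) * mfps_nth H (snd p))"
      by (simp add: times_mfps_def case_prod_unfold sum_distrib_right)
    also have "\<dots> = (\<Sum>(p, q) \<in> (SIGMA p : {p. fst p + snd p = x}. {q. fst q + snd q = fst p}).
        mfps_nth F (fst q) * mfps_nth G (snd q) * mfps_nth H (snd p))"
      using finite_nat_vec_decomp by (intro sum.Sigma) (auto simp: case_prod_unfold)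
    also have "\<dots> = sum ?f {(u, v, w). u + v + w = x}"
      by (intro sum.reindex_bij_witness[of _ "\<lambda>(u, v, w). ((u + v, w), (u, v))"
            "\<lambda>(p, q). (fst q, snd q, snd p)"]) auto
    also have "\<dots> = (\<Sum>(p, q) \<in> (SIGMA p : {p. fst p + snd p = x}. {q. fst q + snd q = snd p}).
        mfps_nth F (fst p) * (mfps_nth G (fst q) * mfps_nth H (snd q)))"
      by (intro sum.reindex_bij_witness[of _ "\<lambda>(p, q). (fst p, fst q, snd q)"
            "\<lambda>(u, v, w). ((u, v + w), (v, w))"]) (auto simp: add.assoc mult.assoc)
    also have "\<dots> = (\<Sum>p | fst p + snd p = x. \<Sum>q | fst q + snd q = snd p.
        mfps_nth F (fst p) * (mfps_nth G (fst q) * mfps_nth H (snd q)))"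
      using finite_nat_vec_decomp by (intro sum.Sigma[symmetric]) (auto simp: case_prod_unfold)
    also have "\<dots> = mfps_nth (F * (G * H)) x"
      by (simp add: times_mfps_def case_prod_unfold sum_distrib_left)
    finally show "mfps_nth (F * G * H) x = mfps_nth (F * (G * H)) x" .
  qed
qed

end

definition mfps_const :: "'a::zero \<Rightarrow> ('a, 'i::finite) mfps" where
  "mfps_const a = Abs_mfps (\<lambda>x. if x = 0 then a else 0)"

definition mfps_var :: "'i::finite \<Rightarrow> ('a::zero_neq_one, 'i) mfps" where
  "mfps_var j = Abs_mfps (\<lambda>x. if x = axis j 1 then 1 else 0)"

definition generating_series :: "(nat ^ 'N::finite \<Rightarrow> complex) \<Rightarrow> (complex, 'N) mfps" where
  "generating_series \<phi> = Abs_mfps \<phi>"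

text \<open>The linear form \<open>\<langle>c, \<xi>\<rangle>\<close>.\<close>

definition linear_form :: "complex ^ 'N::finite \<Rightarrow> (complex, 'N) mfps" where
  "linear_form c = (\<Sum>j\<in>UNIV. mfps_const (c $ j) * mfps_var j)"


section \<open>The operators \<open>\<pi>\<^sub>J\<close>\<close>

text \<open>Setting \<open>\<xi>\<^sub>j = 0\<close> removes exactly the terms whose monomial contains \<open>\<xi>\<^sub>j\<close>.\<close>

definition proj_var :: "'i::finite \<Rightarrow> ('a::zero, 'i) mfps \<Rightarrow> ('a, 'i) mfps" where
  "proj_var j F = Abs_mfps (\<lambda>x. if x $ j = 0 then mfps_nth F x else 0)"

text \<open>
  The index set \<open>{1, \<dots>, N}\<close> is a finite linearly ordered type; ordered subsets are strictly
  increasing lists.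
\<close>

definition ordered_subsets :: "'i::{finite, linorder} list set" where
  "ordered_subsets = {J. sorted_wrt (<) J}"

definition proj_vars :: "'i::finite list \<Rightarrow> ('a::zero, 'i) mfps \<Rightarrow> ('a, 'i) mfps" where
  "proj_vars J = foldr (\<lambda>j P. proj_var j \<circ> P) J id"


section \<open>Cone and vector partition function\<close>

definition int_vec :: "nat ^ 'N::finite \<Rightarrow> int ^ 'N" where
  "int_vec x = (\<chi> j. int (x $ j))"

definition real_vec :: "int ^ 'n::finite \<Rightarrow> real ^ 'n" where
  "real_vec v = (\<chi> i. real_of_int (v $ i))"

definition column_cone :: "int ^ 'N::finite ^ 'n::finite \<Rightarrow> (real ^ 'n) set" where
  "column_cone A =
     {\<Sum>j\<in>UNIV. x $ j *\<^sub>R real_vec (column j A) | x :: real ^ 'N. \<forall>j. 0 \<le> x $ j}"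

definition pointed_columns :: "int ^ 'N::finite ^ 'n::finite \<Rightarrow> bool" where
  "pointed_columns A \<longleftrightarrow>
     (\<exists>l :: real ^ 'n \<Rightarrow> real. linear l \<and> (\<forall>j. 0 < l (real_vec (column j A))))"

definition vector_partition ::
    "int ^ 'N::finite ^ 'n::finite \<Rightarrow> (nat ^ 'N \<Rightarrow> complex) \<Rightarrow> int ^ 'n \<Rightarrow> complex" where
  "vector_partition A \<psi> \<mu> = (\<Sum>x | A *v int_vec x = \<mu>. \<psi> x)"

lemma finite_vector_partition:
  fixes A :: "int ^ 'N::finite ^ 'n::finite"
  assumes "pointed_columns A"
  shows "finite {x :: nat ^ 'N. A *v int_vec x = \<mu>}"
proof -
  obtain l :: "real ^ 'n \<Rightarrow> real" where l: "linear l" and pos: "\<And>j. 0 < l (real_vec (column j A))"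
    using assms by (auto simp: pointed_columns_def)
  define b where "b = (\<lambda>j. nat \<lfloor>l (real_vec \<mu>) / l (real_vec (column j A))\<rfloor>)"
  have "x $ j \<le> b j" if "A *v int_vec x = \<mu>" for x :: "nat ^ 'N" and j
  proof -
    have "real_vec \<mu> = (\<Sum>j\<in>UNIV. real (x $ j) *\<^sub>R real_vec (column j A))"
      by (simp add: vec_eq_iff real_vec_def column_def int_vec_def matrix_vector_mult_def
          mult.commute flip: that)
    then have "l (real_vec \<mu>) = (\<Sum>j\<in>UNIV. real (x $ j) * l (real_vec (column j A)))"
      by (simp add: linear_sum[OF l] linear_scale[OF l])
    also have "real (x $ j) * l (real_vec (column j A)) \<le> \<dots>"
      using pos by (intro member_le_sum mult_nonneg_nonneg) (auto intro: less_imp_le)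
    finally have "real (x $ j) \<le> l (real_vec \<mu>) / l (real_vec (column j A))"
      using pos by (simp add: pos_le_divide_eq)
    then show ?thesis
      unfolding b_def by (simp add: le_nat_floor)
  qed
  then show ?thesis
    by (intro finite_subset[OF _ finite_nat_vec_le[of b]]) auto
qed


section \<open>The difference operator \<open>Q(\<delta>)\<close>\<close>

definition shift :: "'N::finite \<Rightarrow> (nat ^ 'N \<Rightarrow> complex) \<Rightarrow> nat ^ 'N \<Rightarrow> complex" where
  "shift j \<phi> x = \<phi> (x + axis j 1)"

text \<open>The product (composition) of the \<open>\<delta>\<^sub>j\<close>, \<open>j \<in> S\<close>, taken in increasing order of \<open>j\<close>.\<close>

definition shifts ::
    "'N::{finite, linorder} set \<Rightarrow> (nat ^ ('N::{finite, linorder}) \<Rightarrow> complex)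
      \<Rightarrow> nat ^ ('N::{finite, linorder}) \<Rightarrow> complex" where
  "shifts S = foldr (\<lambda>j P. shift j \<circ> P) (sorted_list_of_set S) id"

definition Q_op ::
    "complex ^ 'N::{finite, linorder} \<Rightarrow> (nat ^ ('N::{finite, linorder}) \<Rightarrow> complex)
      \<Rightarrow> nat ^ ('N::{finite, linorder}) \<Rightarrow> complex" where
  "Q_op c \<phi> x = shifts UNIV \<phi> x - (\<Sum>j\<in>UNIV. c $ j * shifts (UNIV - {j}) \<phi> x)"

lemma shifts_eq: "shifts S \<phi> x = \<phi> (x + (\<Sum>j\<in>S. axis j 1))"
proof -
  have "foldr (\<lambda>j P. shift j \<circ> P) js id \<phi> x = \<phi> (x + (\<Sum>j\<leftarrow>js. axis j 1))" for js x
    by (induction js arbitrary: x) (simp_all add: shift_def add.assoc)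
  then show ?thesis
    by (simp add: shifts_def sum_list_distinct_conv_sum_set)
qed

lemma Q_op_eq: "Q_op c \<phi> x = \<phi> (x + 1) - (\<Sum>j\<in>UNIV. c $ j * \<phi> (x + 1 - axis j 1))"
proof -
  have all: "(\<Sum>j\<in>UNIV. axis j 1) = (1 :: (nat, 'a) vec)"
    by (simp add: vec_eq_iff axis_def)
  have "x + (\<Sum>i\<in>UNIV - {j}. axis i 1) = x + 1 - axis j 1" for j
  proof -
    have "axis j 1 + (\<Sum>i\<in>UNIV - {j}. axis i 1) = (1 :: (nat, 'a) vec)"
      using sum.remove[of UNIV j "\<lambda>i. axis i 1 :: (nat, 'a) vec"] all by simp
    then have "x + 1 = axis j 1 + (x + (\<Sum>i\<in>UNIV - {j}. axis i 1))"
      by (metis add.left_commute)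
    then show ?thesis
      by (metis add_diff_cancel_left')
  qed
  then show ?thesis
    by (simp only: Q_op_def shifts_eq all)
qed


section \<open>Formal series in \<open>z\<close>\<close>

text \<open>
  Formal sums \<open>\<Sum> a\<^sub>\<lambda> z\<^sup>\<lambda>\<close> over \<open>\<lambda> \<in> \<int>\<^sup>n\<close>, given by their coefficients. They form a
  module over Laurent polynomials but not a ring, so only multiplication by a monomial is defined.
\<close>

type_synonym 'n zseries = "int ^ 'n \<Rightarrow> complex"

text \<open>
  Substitution \<open>\<xi>\<^sup>x \<mapsto> z\<^bsup>Ax\<^esup>\<close>; the coefficient sums are finite when \<^term>\<open>pointed_columns A\<close> holds,
  see \<open>finite_vector_partition\<close>.
\<close>

definition subst_monomials ::
    "int ^ 'N::finite ^ 'n::finite \<Rightarrow> (complex, 'N) mfps \<Rightarrow> 'n zseries" where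
  "subst_monomials A F = (\<lambda>\<mu>. \<Sum>x | A *v int_vec x = \<mu>. mfps_nth F x)"

text \<open>The series \<open>\<Sum>\<^bsub>\<lambda> \<in> S\<^esub> a\<^sub>\<lambda> z\<^sup>\<lambda>\<close>.\<close>

definition series_on :: "(int ^ 'n::finite) set \<Rightarrow> (int ^ 'n \<Rightarrow> complex) \<Rightarrow> 'n zseries" where
  "series_on S a = (\<lambda>\<mu>. if \<mu> \<in> S then a \<mu> else 0)"

text \<open>
  Multiplication by \<open>z\<^sup>\<nu>\<close>. With \<open>(Q(\<delta>)\<phi>)(x) = \<phi>(x + I) - \<dots>\<close>, the terms of
  \<open>(1 - \<langle>c, \<xi>\<rangle>)\<Phi>(\<xi>)\<close> in which every variable occurs are \<open>(Q(\<delta>)\<phi>)(x) \<xi>\<^bsup>x+I\<^esup>\<close>, so passing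
  to \<open>z\<close> produces a factor \<open>z\<^bsup>AI\<^esup>\<close>, where \<open>I = (1, \<dots>, 1)\<close> and \<open>AI\<close> is the sum of the columns of \<open>A\<close>.
\<close>

definition monomial_times :: "int ^ 'n::finite \<Rightarrow> 'n zseries \<Rightarrow> 'n zseries" where
  "monomial_times \<nu> f = (\<lambda>\<mu>. f (\<mu> - \<nu>))"

end

theory Submission
  imports Defs
begin

text \<open>
  Inclusion--exclusion over the set of vanishing coordinates of \<open>x\<close> shows that
  \<open>\<Sum>\<^sub>J (-1)\<^bsup>#J\<^esup> \<pi>\<^sub>J\<close> keeps exactly the terms \<open>\<xi>\<^sup>x\<close> in which every variable occurs. These are
  the \<open>x = y + I\<close> with \<open>y \<ge> 0\<close>, and there the coefficient of \<open>(1 - \<langle>c, \<xi>\<rangle>) \<Phi>(\<xi>)\<close> is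
  \<open>(Q(\<delta>)\<phi>)(y)\<close>.
\<close>

lemma mfps_nth_sum: "mfps_nth (\<Sum>i\<in>S. F i) x = (\<Sum>i\<in>S. mfps_nth (F i) x)"
  by (induction S rule: infinite_finite_induct) (simp_all add: zero_mfps_def plus_mfps_def)

lemma mfps_nth_diff: "mfps_nth (F - G) x = mfps_nth F x - mfps_nth G x"
  by (simp add: minus_mfps_def)

text \<open>The sign on the left is a power in the ring of series, not a scalar, so it is peeled off
  one negation at a time.\<close>

lemma mfps_nth_signed: "mfps_nth ((- 1) ^ k * F) x = (- 1) ^ k * mfps_nth F x"
proof (induction k)
  case (Suc k)
  have "mfps_nth ((- 1) ^ Suc k * F) x = mfps_nth (- ((- 1) ^ k * F)) x"
    by simp
  also have "\<dots> = - mfps_nth ((- 1) ^ k * F) x"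
    by (simp only: uminus_mfps_def mfps_nth_Abs)
  finally show ?case by (simp add: Suc)
qed simp

lemma mfps_nth_const_mult:
  fixes F :: "('a::comm_ring_1, 'i::finite) mfps"
  shows "mfps_nth (mfps_const a * F) x = a * mfps_nth F x"
proof -
  have "mfps_nth (mfps_const a * F) x
      = (\<Sum>(u, v) | u + v = x. (if u = 0 then a else 0) * mfps_nth F v)"
    by (simp add: times_mfps_def mfps_const_def)
  also have "\<dots> = (\<Sum>(u, v) \<in> {(0 :: nat ^ 'i, x)}. (if u = 0 then a else 0) * mfps_nth F v)"
    by (intro sum.mono_neutral_right finite_nat_vec_decomp) (auto split: if_splits)
  finally show ?thesis by simp
qed

text \<open>Only the decomposition of \<open>x\<close> with first part \<open>axis j 1\<close>
  contributes, and it exists iff \<open>x $ j\<close> is nonzero. The case split matters because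
  subtraction on exponents truncates at 0.\<close>

lemma mfps_nth_var_mult:
  fixes F :: "('a::comm_ring_1, 'i::finite) mfps"
  shows "mfps_nth (mfps_var j * F) x = (if x $ j = 0 then 0 else mfps_nth F (x - axis j 1))"
proof -
  let ?f = "\<lambda>(u :: nat ^ 'i, v). (if u = axis j 1 then 1 else 0) * mfps_nth F v"
  have decomp: "axis j 1 + v = x \<longleftrightarrow> x $ j \<noteq> 0 \<and> v = x - axis j 1" for v
  proof
    assume "axis j 1 + v = x"
    then show "x $ j \<noteq> 0 \<and> v = x - axis j 1"
      by (auto simp: axis_def)
  next
    assume "x $ j \<noteq> 0 \<and> v = x - axis j 1"
    then show "axis j 1 + v = x"
      by (auto simp: vec_eq_iff axis_def)
  qed
  have "mfps_nth (mfps_var j * F) x = sum ?f {(u, v). u + v = x}"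
    by (simp add: times_mfps_def mfps_var_def)
  also have "\<dots> = sum ?f (if x $ j = 0 then {} else {(axis j 1, x - axis j 1)})"
    by (intro sum.mono_neutral_right finite_nat_vec_decomp)
      (auto simp: decomp simp del: One_nat_def split: if_splits)
  finally show ?thesis by simp
qed

lemma mfps_nth_proj_vars:
  "mfps_nth (proj_vars J F) x = (if \<forall>j\<in>set J. x $ j = 0 then mfps_nth F x else 0)"
  unfolding proj_vars_def by (induction J) (auto simp: proj_var_def)

text \<open>Expand the product of the factors \<open>- 1 + 1\<close> over \<open>S\<close>: choosing
  \<open>- 1\<close> exactly on \<open>T\<close> gives the term of \<open>T\<close>, and the product
  is 0 unless it is empty.\<close>

lemma sum_Pow_signs:
  assumes "finite S"
  shows "(\<Sum>T\<in>Pow S. (- 1) ^ card T) = (if S = {} then 1 else 0 :: 'a::comm_ring_1)"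
proof -
  have "(\<Prod>i\<in>S. - 1 + 1) = (\<Sum>T\<in>Pow S. (\<Prod>i\<in>T. - 1) * (\<Prod>i\<in>S - T. 1 :: 'a))"
    using assms by (rule prod_add)
  then show ?thesis
    using assms by (simp add: power_0_left)
qed

text \<open>A strictly increasing list is recovered by sorting its set of entries, so sums over
  \<open>ordered_subsets\<close> become sums over all subsets.\<close>

lemma bij_betw_set_ordered_subsets:
  "bij_betw set ordered_subsets (UNIV :: 'i::{finite, linorder} set set)"
proof (rule bij_betw_byWitness[where f' = sorted_list_of_set])
  show "\<forall>J\<in>ordered_subsets. sorted_list_of_set (set J) = J"
    by (auto simp: ordered_subsets_def strict_sorted_iff sorted_list_of_set.idem_if_sorted_distinct)
qed (auto simp: ordered_subsets_def)

text \<open>The operator of \<open>J\<close> keeps the coefficient at \<open>x\<close> iff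
  \<open>set J\<close> lies in the zero set \<open>?Z\<close> of \<open>x\<close>. The coefficient
  is thus multiplied by the signed count of subsets of \<open>?Z\<close>.\<close>

lemma mfps_nth_inclusion_exclusion:
  fixes F :: "('a::comm_ring_1, 'i::{finite, linorder}) mfps"
  shows "mfps_nth (\<Sum>J\<in>ordered_subsets. (- 1) ^ length J * proj_vars J F) x
    = (if \<forall>j. x $ j \<noteq> 0 then mfps_nth F x else 0)"
proof -
  let ?Z = "{j. x $ j = 0}"
  have len: "length J = card (set J)" if "J \<in> ordered_subsets" for J :: "'i list"
    using that by (simp add: ordered_subsets_def strict_sorted_iff distinct_card)
  have "mfps_nth (\<Sum>J\<in>ordered_subsets. (- 1) ^ length J * proj_vars J F) x
      = (\<Sum>J\<in>ordered_subsets. if set J \<subseteq> ?Z then (- 1) ^ card (set J) * mfps_nth F x else 0)"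
    by (auto simp: mfps_nth_sum mfps_nth_signed mfps_nth_proj_vars len subset_eq intro!: sum.cong)
  also have "\<dots> = (\<Sum>T\<in>UNIV. if T \<subseteq> ?Z then (- 1) ^ card T * mfps_nth F x else 0)"
    by (rule sum.reindex_bij_betw[OF bij_betw_set_ordered_subsets])
  also have "\<dots> = (\<Sum>T\<in>Pow ?Z. (- 1) ^ card T) * mfps_nth F x"
    by (simp add: sum.If_cases Pow_def sum_distrib_right)
  also have "\<dots> = (if \<forall>j. x $ j \<noteq> 0 then mfps_nth F x else 0)"
    by (subst sum_Pow_signs) (auto simp del: neq0_conv)
  finally show ?thesis .
qed

text \<open>No coordinate of \<open>x + 1\<close> vanishes, so multiplying by the variable of index
  \<open>j\<close> always reads off the coefficient at \<open>x + 1 - axis j 1\<close>, as in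
  \<open>Q_op_eq\<close>.\<close>

lemma mfps_nth_linear_form_mult:
  "mfps_nth ((1 - linear_form c) * generating_series \<phi>) (x + 1) = Q_op c \<phi> x"
  by (simp add: linear_form_def left_diff_distrib sum_distrib_right mfps_nth_diff mfps_nth_sum
      mult.assoc mfps_nth_const_mult mfps_nth_var_mult generating_series_def Q_op_eq)

lemma int_vec_add_one: "int_vec (x + 1) = int_vec x + 1"
  by (simp add: int_vec_def vec_eq_iff)

lemma real_vec_mult_int_vec_in_column_cone: "real_vec (A *v int_vec x) \<in> column_cone A"
proof -
  \<comment> \<open>The entries of \<open>x\<close> are themselves the cone coefficients; casting
    them into a real vector supplies the witness.\<close>
  have "real_vec (A *v int_vec x) = (\<Sum>j\<in>UNIV. (\<chi> j. real (x $ j)) $ j *\<^sub>R real_vec (column j A))"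
    by (simp add: vec_eq_iff real_vec_def column_def int_vec_def matrix_vector_mult_def
        mult.commute)
  then show ?thesis
    unfolding column_cone_def by (intro CollectI exI[of _ "\<chi> j. real (x $ j)"]) simp
qed

text \<open>Outside the cone the equation \<open>A *v int_vec x = \<mu>\<close> has no solution, so
  the partition function is an empty sum there.\<close>

lemma series_on_column_cone:
  "series_on {\<mu>. real_vec \<mu> \<in> column_cone A} (vector_partition A \<psi>) = vector_partition A \<psi>"
proof
  fix \<mu>
  have "vector_partition A \<psi> \<mu> = 0" if "real_vec \<mu> \<notin> column_cone A"
  proof -
    have "{x. A *v int_vec x = \<mu>} = {}"
      using that real_vec_mult_int_vec_in_column_cone by blast
    then show ?thesis by (simp add: vector_partition_def)
  qed
  then show "series_on {\<mu>. real_vec \<mu> \<in> column_cone A} (vector_partition A \<psi>) \<mu>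
      = vector_partition A \<psi> \<mu>"
    by (simp add: series_on_def)
qed

theorem theorem1p1:
  fixes A :: "int ^ ('N::{finite, linorder}) ^ ('n::finite)"
    and \<phi> :: "nat ^ ('N::{finite, linorder}) \<Rightarrow> complex"
    and c :: "complex ^ ('N::{finite, linorder})"
  assumes "pointed_columns A"
  shows "subst_monomials A
           (\<Sum>J\<in>ordered_subsets. (- 1) ^ length J
              * proj_vars J ((1 - linear_form c) * generating_series \<phi>))
       = monomial_times (A *v 1)
           (series_on {\<mu>. real_vec \<mu> \<in> column_cone A}
              (vector_partition A (Q_op c \<phi>)))"
proof
  fix \<mu>
  let ?G = "(1 - linear_form c) * generating_series \<phi>"
  \<comment> \<open>Truncated subtraction of the all-ones vector is undone by addition because every
    coordinate is at least 1.\<close>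
  have pos: "x - 1 + 1 = x" if "\<forall>j. x $ j \<noteq> 0" for x :: "nat ^ ('N::{finite, linorder})"
    using that by (simp add: vec_eq_iff Suc_le_eq)
  have shift: "A *v int_vec (y + 1) = \<mu> \<longleftrightarrow> A *v int_vec y = \<mu> - A *v 1" for y
    by (simp add: int_vec_add_one matrix_vector_right_distrib eq_diff_eq)
  have "subst_monomials A (\<Sum>J\<in>ordered_subsets. (- 1) ^ length J * proj_vars J ?G) \<mu>
      = (\<Sum>x | A *v int_vec x = \<mu>. if \<forall>j. x $ j \<noteq> 0 then mfps_nth ?G x else 0)"
    by (simp add: subst_monomials_def mfps_nth_inclusion_exclusion)
  also have "\<dots> = (\<Sum>x | A *v int_vec x = \<mu> \<and> (\<forall>j. x $ j \<noteq> 0). mfps_nth ?G x)"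
    using finite_vector_partition[OF assms, of \<mu>] by (simp add: sum.If_cases Collect_conj_eq)
  \<comment> \<open>Substituting \<open>x = y + 1\<close> moves the fibre from \<open>\<mu>\<close>
    to \<open>\<mu> - A *v 1\<close>; this is the source of the monomial factor.\<close>
  also have "\<dots> = (\<Sum>y | A *v int_vec y = \<mu> - A *v 1. mfps_nth ?G (y + 1))"
  proof (rule sum.reindex_bij_witness[of _ "\<lambda>y. y + 1" "\<lambda>x. x - 1"])
    fix x :: "nat ^ ('N::{finite, linorder})" assume "x \<in> {x. A *v int_vec x = \<mu> \<and> (\<forall>j. x $ j \<noteq> 0)}"
    then show "x - 1 + 1 = x" "x - 1 \<in> {y. A *v int_vec y = \<mu> - A *v 1}"
      "mfps_nth ?G (x - 1 + 1) = mfps_nth ?G x"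
      using shift[of "x - 1"] pos[of x] by simp_all
  next
    fix y :: "nat ^ ('N::{finite, linorder})" assume "y \<in> {y. A *v int_vec y = \<mu> - A *v 1}"
    then show "y + 1 - 1 = y" "y + 1 \<in> {x. A *v int_vec x = \<mu> \<and> (\<forall>j. x $ j \<noteq> 0)}"
      using shift[of y] by simp_all
  qed
  also have "\<dots> = monomial_times (A *v 1) (vector_partition A (Q_op c \<phi>)) \<mu>"
    by (simp add: mfps_nth_linear_form_mult monomial_times_def vector_partition_def)
  finally show "subst_monomials A (\<Sum>J\<in>ordered_subsets. (- 1) ^ length J * proj_vars J ?G) \<mu>
      = monomial_times (A *v 1)
          (series_on {\<mu>. real_vec \<mu> \<in> column_cone A} (vector_partition A (Q_op c \<phi>))) \<mu>"
    by (simp add: series_on_column_cone)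
qed

end
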